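(* Let $n\ge 2$ be an integer. Let $\iota:\mathbb{Z}^n\rtimes S_n\to\mathrm{Sym}([n]\times\mathbb{Z})$ be the injective group homomorphism given by $\iota(\pi,\ell)=\big((a,b)\mapsto(\pi(a),\,b+\ell(a))\big)$, and let $\varsigma:B_n\to\mathbb{Z}^n\rtimes S_n$ be the group homomorphism determined by $\varsigma(\sigma_k)=((k,k+1),\vec{e}_{k+1})$ for $1\le k\le n-1$. Then $GE=\iota\circ\varsigma$.
   Context: $[n]=\{1,\dots,n\}$; $\mathrm{Sym}(X)$ is the group of bijections of $X$ under composition (of functions, right to left). $B_n$ is the braid group on $n$ strands, with presentation by the Artin generators $\sigma_1,\dots,\sigma_{n-1}$ subject to $\sigma_i\sigma_{i+1}\sigma_i=\sigma_{i+1}\sigma_i\sigma_{i+1}$ for all $1\le i\le n-2$ and $\sigma_i\sigma_j=\sigma_j\sigma_i$ whenever $|i-j|>1$. Elements $\ell\in\mathbb{Z}^n$ are regarded as functions $[n]\to\mathbb{Z}$, and $\vec{e}_k$ is the $k$th standard basis vector. Elements of $\mathbb{Z}^n\rtimes S_n$ are written as pairs $(\pi,\ell)$ with $\pi\in S_n$, $\ell\in\mathbb{Z}^n$, and the group law is $(\pi,\ell)(\pi',\ell')=(\pi\pi',\,\ell'+\ell\circ\pi')$. The Gauss-Epple homomorphism $GE:B_n\to\mathrm{Sym}([n]\times\mathbb{Z})$ is the group homomorphism determined by: $GE(\sigma_k)(a,b)=(a,b)$ if $a\notin\{k,k+1\}$, $GE(\sigma_k)(k,b)=(k+1,b)$,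 and $GE(\sigma_k)(k+1,b)=(k,b+1)$, for $1\le k\le n-1$. *)

theory Defs
  imports "HOL-Algebra.Sym_Groups" "HOL-Algebra.Bij"
begin

section \<open>Groups given by a presentation\<close>

text \<open>
  A letter \<open>(s, True)\<close> stands for the generator \<open>s\<close>, and \<open>(s, False)\<close> for its inverse.
\<close>

definition words :: "'s set \<Rightarrow> ('s \<times> bool) list set"
  where "words S = lists (S \<times> UNIV)"

definition positive_word :: "'s list \<Rightarrow> ('s \<times> bool) list"
  where "positive_word = map (\<lambda>s. (s, True))"

text \<open>
  Two words over \<open>S\<close> are related if they represent the same element of the group with generating
  set \<open>S\<close> and defining relations \<open>l = r\<close> for \<open>(l, r) \<in> R\<close>, where \<open>R \<subseteq> words S \<times> words S\<close>.
\<close>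

inductive pres_eq ::
    "'s set \<Rightarrow> (('s \<times> bool) list \<times> ('s \<times> bool) list) set \<Rightarrow>
      ('s \<times> bool) list \<Rightarrow> ('s \<times> bool) list \<Rightarrow> bool"
  for S R where
  refl: "w \<in> words S \<Longrightarrow> pres_eq S R w w"
| sym: "pres_eq S R v w \<Longrightarrow> pres_eq S R w v"
| trans: "pres_eq S R u v \<Longrightarrow> pres_eq S R v w \<Longrightarrow> pres_eq S R u w"
| cancel: "u \<in> words S \<Longrightarrow> v \<in> words S \<Longrightarrow> s \<in> S \<Longrightarrow>
    pres_eq S R (u @ [(s, b), (s, \<not> b)] @ v) (u @ v)"
| relation: "u \<in> words S \<Longrightarrow> v \<in> words S \<Longrightarrow> (l, r) \<in> R \<Longrightarrow>
    pres_eq S R (u @ l @ v) (u @ r @ v)"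

definition pres_class ::
    "'s set \<Rightarrow> (('s \<times> bool) list \<times> ('s \<times> bool) list) set \<Rightarrow>
      ('s \<times> bool) list \<Rightarrow> ('s \<times> bool) list set"
  where "pres_class S R w = {v. pres_eq S R w v}"

definition presented_group ::
    "'s set \<Rightarrow> (('s \<times> bool) list \<times> ('s \<times> bool) list) set \<Rightarrow> ('s \<times> bool) list set monoid"
  where "presented_group S R =
    \<lparr>carrier = words S // {(v, w). pres_eq S R v w},
     mult = (\<lambda>A B. \<Union>a\<in>A. \<Union>b\<in>B. pres_class S R (a @ b)),
     one = pres_class S R []\<rparr>"


section \<open>The braid group on \<open>n\<close> strands\<close>

definition braid_relations :: "nat \<Rightarrow> ((nat \<times> bool) list \<times> (nat \<times> bool) list) set"
  where "braid_relations n =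
    {(positive_word [i, i + 1, i], positive_word [i + 1, i, i + 1]) | i. 1 \<le> i \<and> i + 1 < n} \<union>
    {(positive_word [i, j], positive_word [j, i]) | i j.
       i \<in> {1..<n} \<and> j \<in> {1..<n} \<and> \<bar>int i - int j\<bar> > 1}"

definition braid_group :: "nat \<Rightarrow> (nat \<times> bool) list set monoid"
  where "braid_group n = presented_group {1..<n} (braid_relations n)"

definition artin_gen :: "nat \<Rightarrow> nat \<Rightarrow> (nat \<times> bool) list set"
  where "artin_gen n k = pres_class {1..<n} (braid_relations n) (positive_word [k])"


section \<open>The groups \<open>Sym([n] \<times> \<int>)\<close> and \<open>\<int>\<^sup>n \<rtimes> S\<^sub>n\<close>\<close>

abbreviation strands :: "nat \<Rightarrow> (nat \<times> int) set"
  where "strands n \<equiv> {1..n} \<times> UNIV"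

text \<open>
  Elements of \<open>\<int>\<^sup>n\<close> are functions on \<open>{1..n}\<close>, which are taken to be \<^const>\<open>extensional\<close> so that
  each element has a unique representative.  Elements of \<open>S\<^sub>n\<close> fix everything outside \<open>{1..n}\<close>.
\<close>

definition semidirect :: "nat \<Rightarrow> ((nat \<Rightarrow> nat) \<times> (nat \<Rightarrow> int)) monoid"
  where "semidirect n =
    \<lparr>carrier = carrier (sym_group n) \<times> ({1..n} \<rightarrow>\<^sub>E UNIV),
     mult = (\<lambda>(p, l) (p', l'). (p \<otimes>\<^bsub>sym_group n\<^esub> p', \<lambda>a\<in>{1..n}. l' a + l (p' a))),
     one = (\<one>\<^bsub>sym_group n\<^esub>, \<lambda>a\<in>{1..n}. 0)\<rparr>"

definition basis_vec :: "nat \<Rightarrow> nat \<Rightarrow> (nat \<Rightarrow> int)"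
  where "basis_vec n k = (\<lambda>a\<in>{1..n}. if a = k then 1 else 0)"


section \<open>The homomorphisms\<close>

definition iota :: "nat \<Rightarrow> (nat \<Rightarrow> nat) \<times> (nat \<Rightarrow> int) \<Rightarrow> (nat \<times> int \<Rightarrow> nat \<times> int)"
  where "iota n = (\<lambda>(p, l). \<lambda>(a, b)\<in>strands n. (p a, b + l a))"

text \<open>
  A homomorphism out of the braid group is pinned down by its values on the Artin generators only
  as a function on the carrier, whence the extensionality conditions below.
\<close>

definition is_varsigma ::
    "nat \<Rightarrow> ((nat \<times> bool) list set \<Rightarrow> (nat \<Rightarrow> nat) \<times> (nat \<Rightarrow> int)) \<Rightarrow> bool"
  where "is_varsigma n f \<longleftrightarrow>
    group_hom (braid_group n) (semidirect n) f \<and> f \<in> extensional (carrier (braid_group n)) \<and>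
    (\<forall>k\<in>{1..<n}. f (artin_gen n k) = (transpose k (k + 1), basis_vec n (k + 1)))"

definition varsigma :: "nat \<Rightarrow> (nat \<times> bool) list set \<Rightarrow> (nat \<Rightarrow> nat) \<times> (nat \<Rightarrow> int)"
  where "varsigma n = (THE f. is_varsigma n f)"

definition is_gauss_epple ::
    "nat \<Rightarrow> ((nat \<times> bool) list set \<Rightarrow> (nat \<times> int \<Rightarrow> nat \<times> int)) \<Rightarrow> bool"
  where "is_gauss_epple n f \<longleftrightarrow>
    group_hom (braid_group n) (BijGroup (strands n)) f \<and>
    f \<in> extensional (carrier (braid_group n)) \<and>
    (\<forall>k\<in>{1..<n}.
       (\<forall>a\<in>{1..n}. \<forall>b. a \<notin> {k, k + 1} \<longrightarrow> f (artin_gen n k) (a, b) = (a, b)) \<and>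
       (\<forall>b. f (artin_gen n k) (k, b) = (k + 1, b)) \<and>
       (\<forall>b. f (artin_gen n k) (k + 1, b) = (k, b + 1)))"

definition gauss_epple :: "nat \<Rightarrow> (nat \<times> bool) list set \<Rightarrow> (nat \<times> int \<Rightarrow> nat \<times> int)"
  where "gauss_epple n = (THE f. is_gauss_epple n f)"

end

theory Submission
  imports Defs
begin

text \<open>
  Both \<open>GE\<close> and \<open>\<iota> \<circ> \<varsigma>\<close> are homomorphisms out of the braid group, and a homomorphism out of a
  presented group is determined by its values on the generators (\<open>hom_eqI\<close> below), so it is enough
  that \<open>\<iota> (\<varsigma> \<sigma>\<^sub>k)\<close> acts as prescribed for \<open>GE \<sigma>\<^sub>k\<close>: the transposition moves the strand, and the
  basis vector \<open>e\<^sub>k\<^sub>+\<^sub>1\<close> raises the second coordinate exactly when the strand starts at \<open>k + 1\<close>.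

  The existence of \<open>\<varsigma>\<close> is von Dyck's theorem: a map from the generators to a group extends to the
  presented group as soon as it respects the defining relations (\<open>ex_hom\<close>). The braid relations are
  thus only needed for the pairs \<open>((k, k + 1), e\<^sub>k\<^sub>+\<^sub>1)\<close> in the semidirect product. The existence of
  \<open>GE\<close> then requires no second verification of relations, because \<open>\<iota> \<circ> \<varsigma>\<close> itself is a witness.
\<close>


section \<open>Groups given by a presentation\<close>

lemma words_simps [simp]:
  "[] \<in> words S"
  "x # w \<in> words S \<longleftrightarrow> fst x \<in> S \<and> w \<in> words S"
  "u @ v \<in> words S \<longleftrightarrow> u \<in> words S \<and> v \<in> words S"
  by (auto simp: words_def mem_Times_iff)

definition inverse_word :: "('s \<times> bool) list \<Rightarrow> ('s \<times> bool) list"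
  where "inverse_word w = rev (map (\<lambda>(s, b). (s, \<not> b)) w)"

lemma inverse_word_simps [simp]:
  "inverse_word [] = []"
  "inverse_word ((s, b) # w) = inverse_word w @ [(s, \<not> b)]"
  by (simp_all add: inverse_word_def)

lemma inverse_word_in_words: "w \<in> words S \<Longrightarrow> inverse_word w \<in> words S"
  by (induction w) auto

locale presentation =
  fixes S :: "'s set" and R :: "(('s \<times> bool) list \<times> ('s \<times> bool) list) set"
  assumes relations_in_words: "R \<subseteq> words S \<times> words S"
begin

abbreviation cls :: "('s \<times> bool) list \<Rightarrow> ('s \<times> bool) list set"
  where "cls \<equiv> pres_class S R"

abbreviation P :: "('s \<times> bool) list set monoid"
  where "P \<equiv> presented_group S R"

lemma pres_eq_in_words: "pres_eq S R u v \<Longrightarrow> u \<in> words S \<and> v \<in> words S"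
  by (induction rule: pres_eq.induct) (use relations_in_words in auto)

lemma pres_eq_context:
  assumes "pres_eq S R u v" "x \<in> words S" "y \<in> words S"
  shows "pres_eq S R (x @ u @ y) (x @ v @ y)"
  using assms
proof (induction rule: pres_eq.induct)
  case (refl w)
  then show ?case by (auto intro: pres_eq.refl)
next
  case (sym v w)
  then show ?case by (auto intro: pres_eq.sym)
next
  case (trans u v w)
  then show ?case by (blast intro: pres_eq.trans)
next
  case (cancel u v s b)
  then show ?case using pres_eq.cancel[of "x @ u" S "v @ y" s R b] by simp
next
  case (relation u v l r)
  then show ?case using pres_eq.relation[of "x @ u" S "v @ y" l r R] by simp
qed

lemma pres_eq_append:
  assumes "pres_eq S R u u'" "pres_eq S R v v'"
  shows "pres_eq S R (u @ v) (u' @ v')"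
proof (rule pres_eq.trans)
  show "pres_eq S R (u @ v) (u' @ v)"
    using pres_eq_context[OF assms(1), of "[]" v] pres_eq_in_words[OF assms(2)] by simp
  show "pres_eq S R (u' @ v) (u' @ v')"
    using pres_eq_context[OF assms(2), of u' "[]"] pres_eq_in_words[OF assms(1)] by simp
qed

lemma cls_eq_iff:
  assumes "u \<in> words S"
  shows "cls u = cls v \<longleftrightarrow> pres_eq S R u v"
proof
  assume "cls u = cls v"
  moreover have "u \<in> cls u"
    using assms by (simp add: pres_class_def pres_eq.refl)
  ultimately show "pres_eq S R u v"
    by (simp add: pres_class_def pres_eq.sym)
next
  assume uv: "pres_eq S R u v"
  have "pres_eq S R u w \<longleftrightarrow> pres_eq S R v w" for w
    using pres_eq.trans[OF uv] pres_eq.trans[OF pres_eq.sym[OF uv]] by blast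
  then show "cls u = cls v"
    by (simp add: pres_class_def)
qed

lemma carrier_P: "carrier P = cls ` words S"
  by (auto simp: presented_group_def quotient_def pres_class_def)

lemma cls_in_carrier: "w \<in> words S \<Longrightarrow> cls w \<in> carrier P"
  by (simp add: carrier_P)

lemma one_P: "\<one>\<^bsub>P\<^esub> = cls []"
  by (simp add: presented_group_def)

lemma mult_P:
  assumes "u \<in> words S" "v \<in> words S"
  shows "cls u \<otimes>\<^bsub>P\<^esub> cls v = cls (u @ v)"
proof -
  have "cls (a @ b) = cls (u @ v)" if "a \<in> cls u" "b \<in> cls v" for a b
    using that assms cls_eq_iff[of "u @ v" "a @ b"] pres_eq_append[of u a v b]
    by (simp add: pres_class_def)
  then have "cls u \<otimes>\<^bsub>P\<^esub> cls v = (\<Union>a\<in>cls u. \<Union>b\<in>cls v. cls (u @ v))"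
    by (simp add: presented_group_def)
  moreover have "cls u \<noteq> {}" "cls v \<noteq> {}"
    using assms by (auto simp: pres_class_def intro: pres_eq.refl)
  ultimately show ?thesis
    by simp
qed

lemma pres_eq_inverse_word: "w \<in> words S \<Longrightarrow> pres_eq S R (inverse_word w @ w) []"
proof (induction w)
  case Nil
  then show ?case by (simp add: pres_eq.refl)
next
  case (Cons x w)
  obtain s b where x: "x = (s, b)" by fastforce
  \<comment> \<open>The double negation gives the middle pair the shape that the cancellation rule asks for.\<close>
  have "pres_eq S R (inverse_word w @ [(s, \<not> b), (s, \<not> \<not> b)] @ w) (inverse_word w @ w)"
    using Cons.prems x inverse_word_in_words[of w S] by (intro pres_eq.cancel) auto
  then show ?case
    using Cons x pres_eq.trans[of S R _ "inverse_word w @ w" "[]"] by simp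
qed

lemma group_P: "group P"
proof (rule groupI)
  fix A B C
  assume "A \<in> carrier P"
  then obtain u where u: "u \<in> words S" "A = cls u"
    by (auto simp: carrier_P)
  show "\<one>\<^bsub>P\<^esub> \<otimes>\<^bsub>P\<^esub> A = A"
    using u by (simp add: one_P mult_P)
  have "cls (inverse_word u) \<otimes>\<^bsub>P\<^esub> A = \<one>\<^bsub>P\<^esub>"
    using u inverse_word_in_words[of u S] pres_eq_inverse_word[of u]
    by (simp add: one_P mult_P cls_eq_iff)
  then show "\<exists>D\<in>carrier P. D \<otimes>\<^bsub>P\<^esub> A = \<one>\<^bsub>P\<^esub>"
    using u inverse_word_in_words[of u S] by (blast intro: cls_in_carrier)
  assume "B \<in> carrier P"
  then obtain v where v: "v \<in> words S" "B = cls v"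
    by (auto simp: carrier_P)
  show "A \<otimes>\<^bsub>P\<^esub> B \<in> carrier P"
    using u v by (simp add: cls_in_carrier mult_P)
  assume "C \<in> carrier P"
  then obtain w where "w \<in> words S" "C = cls w"
    by (auto simp: carrier_P)
  with u v show "A \<otimes>\<^bsub>P\<^esub> B \<otimes>\<^bsub>P\<^esub> C = A \<otimes>\<^bsub>P\<^esub> (B \<otimes>\<^bsub>P\<^esub> C)"
    by (simp add: mult_P)
next
  show "\<one>\<^bsub>P\<^esub> \<in> carrier P"
    by (simp add: cls_in_carrier one_P)
qed

lemma cls_inverse_letter:
  assumes "s \<in> S"
  shows "cls [(s, False)] = inv\<^bsub>P\<^esub> (cls [(s, True)])"
proof (rule group.inv_equality[OF group_P, symmetric])
  show "cls [(s, False)] \<otimes>\<^bsub>P\<^esub> cls [(s, True)] = \<one>\<^bsub>P\<^esub>"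
    using assms pres_eq.cancel[of "[]" S "[]" s R False] by (simp add: mult_P one_P cls_eq_iff)
qed (use assms in \<open>simp_all add: cls_in_carrier\<close>)

text \<open>
  Every class is a product of generators and their inverses, and a homomorphism preserves both
  operations. Extensionality fixes the values off the carrier.
\<close>

lemma hom_eqI:
  assumes "group_hom P G f" "group_hom P G g"
    and gens: "\<And>s. s \<in> S \<Longrightarrow> f (cls [(s, True)]) = g (cls [(s, True)])"
    and ext: "f \<in> extensional (carrier P)" "g \<in> extensional (carrier P)"
  shows "f = g"
proof (rule extensionalityI[OF ext])
  interpret f: group_hom P G f by fact
  interpret g: group_hom P G g by fact
  have letter: "f (cls [(s, b)]) = g (cls [(s, b)])" if "s \<in> S" for s b
    using that gens[OF that] by (cases b) (simp_all add: cls_inverse_letter cls_in_carrier)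
  have "f (cls w) = g (cls w)" if "w \<in> words S" for w
    using that
  proof (induction w)
    case Nil
    show ?case using f.hom_one g.hom_one by (simp add: one_P)
  next
    case (Cons x w)
    obtain s b where x: "x = (s, b)" by fastforce
    have "cls (x # w) = cls [(s, b)] \<otimes>\<^bsub>P\<^esub> cls w"
      using Cons.prems x by (simp add: mult_P)
    moreover have "cls [(s, b)] \<in> carrier P" "cls w \<in> carrier P"
      using Cons.prems x by (simp_all add: cls_in_carrier)
    ultimately show ?case
      using Cons x letter[of s b] by simp
  qed
  then show "f A = g A" if "A \<in> carrier P" for A
    using that by (auto simp: carrier_P)
qed

end

fun eval_word :: "('a, 'b) monoid_scheme \<Rightarrow> ('s \<Rightarrow> 'a) \<Rightarrow> ('s \<times> bool) list \<Rightarrow> 'a" where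
  "eval_word G g [] = \<one>\<^bsub>G\<^esub>"
| "eval_word G g ((s, b) # w) = (if b then g s else inv\<^bsub>G\<^esub> g s) \<otimes>\<^bsub>G\<^esub> eval_word G g w"

context group
begin

lemma eval_word_closed:
  assumes "g \<in> S \<rightarrow> carrier G" "w \<in> words S"
  shows "eval_word G g w \<in> carrier G"
  using assms(2)
proof (induction w)
  case (Cons x w)
  then show ?case using assms(1) by (cases x) (auto simp: Pi_iff)
qed auto

lemma eval_word_append:
  assumes "g \<in> S \<rightarrow> carrier G" "u \<in> words S" "v \<in> words S"
  shows "eval_word G g (u @ v) = eval_word G g u \<otimes> eval_word G g v"
  using assms(2)
proof (induction u)
  case Nil
  then show ?case using eval_word_closed[OF assms(1,3)] by simp
next
  case (Cons x u)
  then show ?case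
    using assms(1) eval_word_closed[OF assms(1), of u] eval_word_closed[OF assms(1,3)]
    by (cases x) (auto simp: Pi_iff m_assoc)
qed

lemma eval_word_respects_pres_eq:
  assumes "presentation S R" "g \<in> S \<rightarrow> carrier G"
    and rels: "\<And>l r. (l, r) \<in> R \<Longrightarrow> eval_word G g l = eval_word G g r"
    and "pres_eq S R u v"
  shows "eval_word G g u = eval_word G g v"
  using assms(4)
proof (induction rule: pres_eq.induct)
  case (cancel u v s b)
  have "g s \<in> carrier G" using cancel assms(2) by auto
  then have "eval_word G g [(s, b), (s, \<not> b)] = \<one>" by simp
  then show ?case
    using cancel eval_word_closed[OF assms(2)] eval_word_append[OF assms(2), of u "[(s, b), (s, \<not> b)] @ v"]
      eval_word_append[OF assms(2), of "[(s, b), (s, \<not> b)]" v] eval_word_append[OF assms(2), of u v]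
    by (simp del: eval_word.simps append_Cons)
next
  case (relation u v l r)
  then have "l \<in> words S" "r \<in> words S"
    using assms(1) by (auto simp: presentation_def)
  then show ?case
    using relation rels[of l r] by (simp add: eval_word_append[OF assms(2)])
qed auto

text \<open>
  Von Dyck's theorem: evaluation of words is constant on classes, so it descends to the quotient.
\<close>

lemma ex_hom:
  assumes "presentation S R" "g \<in> S \<rightarrow> carrier G"
    and rels: "\<And>l r. (l, r) \<in> R \<Longrightarrow> eval_word G g l = eval_word G g r"
  shows "\<exists>f. group_hom (presented_group S R) G f \<and>
    f \<in> extensional (carrier (presented_group S R)) \<and>
    (\<forall>s\<in>S. f (pres_class S R [(s, True)]) = g s)"
proof -
  interpret presentation S R by fact
  define f where "f = (\<lambda>A\<in>carrier P. the_elem (eval_word G g ` A))"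
  have f: "f (cls w) = eval_word G g w" if "w \<in> words S" for w
  proof -
    have "w \<in> cls w" using that by (simp add: pres_class_def pres_eq.refl)
    moreover have "eval_word G g v = eval_word G g w" if "v \<in> cls w" for v
      using that eval_word_respects_pres_eq[OF assms, of w v] by (simp add: pres_class_def)
    ultimately have "eval_word G g ` cls w = {eval_word G g w}" by blast
    then show ?thesis using that by (simp add: f_def cls_in_carrier)
  qed
  have "f \<in> hom P G"
    using eval_word_closed[OF assms(2)]
    by (auto simp: hom_def carrier_P mult_P f eval_word_append[OF assms(2)])
  moreover have "f (cls [(s, True)]) = g s" if "s \<in> S" for s
    using that assms(2) by (auto simp: f Pi_iff)
  ultimately show ?thesis
    using group_P is_group by (auto simp: group_hom_def group_hom_axioms_def f_def)
qed

end


section \<open>The semidirect product and its action on strands\<close>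

lemma mem_carrier_semidirect:
  "(p, l) \<in> carrier (semidirect n) \<longleftrightarrow> p permutes {1..n} \<and> l \<in> extensional {1..n}"
  by (simp add: semidirect_def sym_group_def PiE_def)

lemma mult_semidirect:
  "(p, l) \<otimes>\<^bsub>semidirect n\<^esub> (p', l') = (p \<circ> p', \<lambda>a\<in>{1..n}. l' a + l (p' a))"
  by (simp add: semidirect_def sym_group_def)

lemma one_semidirect: "\<one>\<^bsub>semidirect n\<^esub> = (id, \<lambda>a\<in>{1..n}. 0)"
  by (simp add: semidirect_def sym_group_def)

text \<open>
  Membership in \<open>{1..n}\<close> is spelled out in the form to which the simplifier reduces it.
\<close>

lemma permutes_mem: "p permutes {1..n} \<Longrightarrow> Suc 0 \<le> p a \<and> p a \<le> n \<longleftrightarrow> Suc 0 \<le> a \<and> a \<le> n"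
  using permutes_in_image[of p "{1..n}" a] by simp

lemma group_semidirect: "group (semidirect n)"
proof (rule groupI)
  fix x y z
  assume "x \<in> carrier (semidirect n)"
  then obtain p l where x: "x = (p, l)" "p permutes {1..n}" "l \<in> extensional {1..n}"
    by (cases x) (auto simp: mem_carrier_semidirect)
  show "\<one>\<^bsub>semidirect n\<^esub> \<otimes>\<^bsub>semidirect n\<^esub> x = x"
    using x by (auto simp: one_semidirect mult_semidirect permutes_mem fun_eq_iff extensional_def)
  have "(Hilbert_Choice.inv p, \<lambda>a\<in>{1..n}. - l (Hilbert_Choice.inv p a)) \<otimes>\<^bsub>semidirect n\<^esub> x = \<one>\<^bsub>semidirect n\<^esub>"
    using x by (auto simp: one_semidirect mult_semidirect permutes_mem permutes_inverses
        permutes_inv_o fun_eq_iff)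
  moreover have "(Hilbert_Choice.inv p, \<lambda>a\<in>{1..n}. - l (Hilbert_Choice.inv p a)) \<in> carrier (semidirect n)"
    using x by (simp add: mem_carrier_semidirect permutes_inv)
  ultimately show "\<exists>x'\<in>carrier (semidirect n). x' \<otimes>\<^bsub>semidirect n\<^esub> x = \<one>\<^bsub>semidirect n\<^esub>"
    by blast
  assume "y \<in> carrier (semidirect n)"
  then obtain p' l' where y: "y = (p', l')" "p' permutes {1..n}" "l' \<in> extensional {1..n}"
    by (cases y) (auto simp: mem_carrier_semidirect)
  show "x \<otimes>\<^bsub>semidirect n\<^esub> y \<in> carrier (semidirect n)"
    using x y by (simp add: mem_carrier_semidirect mult_semidirect permutes_compose)
  assume "z \<in> carrier (semidirect n)"
  then obtain p'' l'' where z: "z = (p'', l'')" "p'' permutes {1..n}" "l'' \<in> extensional {1..n}"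
    by (cases z) (auto simp: mem_carrier_semidirect)
  show "x \<otimes>\<^bsub>semidirect n\<^esub> y \<otimes>\<^bsub>semidirect n\<^esub> z = x \<otimes>\<^bsub>semidirect n\<^esub> (y \<otimes>\<^bsub>semidirect n\<^esub> z)"
    using x y z by (auto simp: mult_semidirect permutes_mem fun_eq_iff)
qed (auto simp: one_semidirect mem_carrier_semidirect permutes_id)

lemma iota_apply:
  "iota n (p, l) (a, b) = (if a \<in> {1..n} then (p a, b + l a) else undefined)"
  by (simp add: iota_def)

lemma iota_in_Bij:
  assumes "p permutes {1..n}"
  shows "iota n (p, l) \<in> Bij (strands n)"
proof -
  have "bij_betw (iota n (p, l)) (strands n) (strands n)"
    using assms
    by (intro bij_betw_byWitness[where f' = "\<lambda>(a, b). (Hilbert_Choice.inv p a, b - l (Hilbert_Choice.inv p a))"])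
      (auto simp: iota_apply permutes_mem permutes_inv permutes_inverses)
  moreover have "iota n (p, l) \<in> extensional (strands n)"
    by (auto simp: iota_apply extensional_def)
  ultimately show ?thesis by (simp add: Bij_def)
qed

lemma group_hom_iota: "group_hom (semidirect n) (BijGroup (strands n)) (iota n)"
proof -
  have "iota n \<in> hom (semidirect n) (BijGroup (strands n))"
  proof (rule homI)
    fix x
    assume "x \<in> carrier (semidirect n)"
    then obtain p l where x: "x = (p, l)" "p permutes {1..n}"
      by (cases x) (auto simp: mem_carrier_semidirect)
    then show "iota n x \<in> carrier (BijGroup (strands n))"
      using iota_in_Bij[of p n l] by (simp add: BijGroup_def)
    fix y
    assume "y \<in> carrier (semidirect n)"
    then obtain p' l' where y: "y = (p', l')" "p' permutes {1..n}"
      by (cases y) (auto simp: mem_carrier_semidirect)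
    show "iota n (x \<otimes>\<^bsub>semidirect n\<^esub> y) = iota n x \<otimes>\<^bsub>BijGroup (strands n)\<^esub> iota n y"
      using x y iota_in_Bij[OF x(2)] iota_in_Bij[OF y(2)]
      by (auto simp: BijGroup_def mult_semidirect iota_apply compose_def
          permutes_mem fun_eq_iff)
  qed
  then show ?thesis
    using group_semidirect group_BijGroup by (auto simp: group_hom_def group_hom_axioms_def)
qed

lemma inj_on_iota: "inj_on (iota n) (carrier (semidirect n))"
proof (rule inj_onI)
  fix x y
  assume "x \<in> carrier (semidirect n)" "y \<in> carrier (semidirect n)" and eq: "iota n x = iota n y"
  then obtain p l p' l' where
    x: "x = (p, l)" "p permutes {1..n}" "l \<in> extensional {1..n}" and
    y: "y = (p', l')" "p' permutes {1..n}" "l' \<in> extensional {1..n}"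
    by (cases x; cases y) (auto simp: mem_carrier_semidirect)
  have *: "p a = p' a \<and> l a = l' a" if "a \<in> {1..n}" for a
    using fun_cong[OF eq, of "(a, 0)"] that x y by (simp add: iota_apply)
  have "p a = p' a" for a
    using * permutes_not_in[OF x(2), of a] permutes_not_in[OF y(2), of a] by metis
  then have "p = p'" ..
  moreover have "l = l'"
    using x y * by (auto intro: extensionalityI)
  ultimately show "x = y"
    using x y by simp
qed


section \<open>The two homomorphisms out of the braid group\<close>

abbreviation (input) sd_gen :: "nat \<Rightarrow> nat \<Rightarrow> (nat \<Rightarrow> nat) \<times> (nat \<Rightarrow> int)"
  where "sd_gen n k \<equiv> (transpose k (k + 1), basis_vec n (k + 1))"

lemma presentation_braid: "presentation {1..<n} (braid_relations n)"
  by unfold_locales (auto simp: braid_relations_def positive_word_def)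

lemma sd_gen_closed: "k \<in> {1..<n} \<Longrightarrow> sd_gen n k \<in> carrier (semidirect n)"
  by (auto simp: mem_carrier_semidirect basis_vec_def intro!: permutes_swap_id)

lemma iota_sd_gen:
  assumes "k \<in> {1..<n}"
  shows "a \<in> {1..n} \<Longrightarrow> a \<notin> {k, k + 1} \<Longrightarrow> iota n (sd_gen n k) (a, b) = (a, b)"
    and "iota n (sd_gen n k) (k, b) = (k + 1, b)"
    and "iota n (sd_gen n k) (k + 1, b) = (k, b + 1)"
  using assms by (auto simp: iota_apply basis_vec_def transpose_def)

text \<open>
  Both sides equal \<open>((i, i + 2), e\<^sub>i\<^sub>+\<^sub>1 + 2 e\<^sub>i\<^sub>+\<^sub>2)\<close>: in either order, the strand starting at \<open>j\<close> is
  overtaken once by each of the strands starting at \<open>i, \<dots>, j - 1\<close>, and each time it gains \<open>1\<close>.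
\<close>

lemma sd_gen_braid:
  assumes "1 \<le> i" "i + 1 < n"
  shows "sd_gen n i \<otimes>\<^bsub>semidirect n\<^esub> (sd_gen n (i + 1) \<otimes>\<^bsub>semidirect n\<^esub> sd_gen n i) =
    sd_gen n (i + 1) \<otimes>\<^bsub>semidirect n\<^esub> (sd_gen n i \<otimes>\<^bsub>semidirect n\<^esub> sd_gen n (i + 1))"
  using assms by (auto simp: mult_semidirect basis_vec_def transpose_def fun_eq_iff)

lemma sd_gen_commute:
  assumes "i \<in> {1..<n}" "j \<in> {1..<n}" "\<bar>int i - int j\<bar> > 1"
  shows "sd_gen n i \<otimes>\<^bsub>semidirect n\<^esub> sd_gen n j = sd_gen n j \<otimes>\<^bsub>semidirect n\<^esub> sd_gen n i"
  using assms by (auto simp: mult_semidirect basis_vec_def transpose_def fun_eq_iff)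

lemma ex1_varsigma: "\<exists>!f. is_varsigma n f"
proof -
  interpret G: group "semidirect n" by (rule group_semidirect)
  let ?e = "eval_word (semidirect n) (sd_gen n)"
  have rels: "?e l = ?e r" if "(l, r) \<in> braid_relations n" for l r
    using that unfolding braid_relations_def
  proof (elim UnE CollectE exE conjE Pair_inject)
    fix i
    assume i: "1 \<le> i" "i + 1 < n"
      and "l = positive_word [i, i + 1, i]" "r = positive_word [i + 1, i, i + 1]"
    moreover have "sd_gen n i \<in> carrier (semidirect n)" "sd_gen n (i + 1) \<in> carrier (semidirect n)"
      using i sd_gen_closed[of i n] sd_gen_closed[of "i + 1" n] by simp_all
    ultimately show ?thesis
      using sd_gen_braid[OF i] by (simp add: positive_word_def)
  next
    fix i j
    assume ij: "i \<in> {1..<n}" "j \<in> {1..<n}" "\<bar>int i - int j\<bar> > 1"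
      and "l = positive_word [i, j]" "r = positive_word [j, i]"
    then show ?thesis
      using sd_gen_commute[OF ij] sd_gen_closed[OF ij(1)] sd_gen_closed[OF ij(2)]
      by (simp add: positive_word_def)
  qed
  show ?thesis
  proof (rule ex_ex1I)
    show "\<exists>f. is_varsigma n f"
      using G.ex_hom[OF presentation_braid _ rels] sd_gen_closed
      by (simp add: is_varsigma_def braid_group_def artin_gen_def positive_word_def Pi_iff)
    show "f = g" if "is_varsigma n f" "is_varsigma n g" for f g
      using that
      by (intro presentation.hom_eqI[OF presentation_braid, of n "semidirect n"])
        (auto simp: is_varsigma_def braid_group_def artin_gen_def positive_word_def)
  qed
qed

text \<open>
  The image of each Artin generator lies in \<^const>\<open>Bij\<close>, hence is extensional, and so is determined
  by the prescribed values on the strands.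
\<close>

lemma gauss_epple_unique:
  assumes f: "is_gauss_epple n f" and g: "is_gauss_epple n g"
  shows "f = g"
proof (rule presentation.hom_eqI[OF presentation_braid, of n "BijGroup (strands n)"])
  fix k
  assume k: "k \<in> {1..<n}"
  let ?\<sigma> = "artin_gen n k"
  have "?\<sigma> \<in> carrier (braid_group n)"
    using k presentation.carrier_P[OF presentation_braid]
    by (simp add: braid_group_def artin_gen_def positive_word_def)
  then have *: "h ?\<sigma> \<in> extensional (strands n)" if "is_gauss_epple n h" for h
    using that group_hom.hom_closed[of "braid_group n" "BijGroup (strands n)" h ?\<sigma>]
    by (simp add: is_gauss_epple_def BijGroup_def Bij_def)
  have "f ?\<sigma> = g ?\<sigma>"
  proof (rule extensionalityI[OF *[OF f] *[OF g]])
    fix x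
    assume "x \<in> strands n"
    then obtain a b where x: "x = (a, b)" "a \<in> {1..n}" by auto
    consider "a = k" | "a = k + 1" | "a \<notin> {k, k + 1}" by blast
    then show "f ?\<sigma> x = g ?\<sigma> x"
      using f g k x by cases (simp_all add: is_gauss_epple_def)
  qed
  then show "f (pres_class {1..<n} (braid_relations n) [(k, True)]) =
      g (pres_class {1..<n} (braid_relations n) [(k, True)])"
    by (simp add: artin_gen_def positive_word_def)
qed (use f g in \<open>auto simp: is_gauss_epple_def braid_group_def\<close>)

text \<open>
  The composite is a homomorphism for free; its values on the generators are those of
  \<open>iota_sd_gen\<close>.
\<close>

lemma gauss_epple_compose:
  assumes "is_varsigma n f"
  shows "is_gauss_epple n (compose (carrier (braid_group n)) (iota n) f)"
proof -
  interpret f: group_hom "braid_group n" "semidirect n" f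
    using assms by (simp add: is_varsigma_def)
  interpret i: group_hom "semidirect n" "BijGroup (strands n)" "iota n"
    by (rule group_hom_iota)
  let ?c = "compose (carrier (braid_group n)) (iota n) f"
  have "?c \<in> hom (braid_group n) (BijGroup (strands n))"
    by (rule homI) (simp_all add: compose_def del: One_nat_def)
  then have "group_hom (braid_group n) (BijGroup (strands n)) ?c"
    using f.is_group i.H.is_group by (simp add: group_hom_def group_hom_axioms_def)
  moreover have "?c (artin_gen n k) = iota n (sd_gen n k)" if "k \<in> {1..<n}" for k
    using that assms presentation.carrier_P[OF presentation_braid]
    by (simp add: compose_def is_varsigma_def braid_group_def artin_gen_def positive_word_def)
  ultimately show ?thesis
    using iota_sd_gen by (simp add: is_gauss_epple_def)
qed

theorem theorem2p6:
  fixes n :: nat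
  assumes "n \<ge> 2"
  shows "group_hom (semidirect n) (BijGroup (strands n)) (iota n) \<and>
    inj_on (iota n) (carrier (semidirect n)) \<and>
    (\<exists>!f. is_varsigma n f) \<and>
    (\<exists>!f. is_gauss_epple n f) \<and>
    gauss_epple n = compose (carrier (braid_group n)) (iota n) (varsigma n)"
proof -
  have "is_varsigma n (varsigma n)"
    unfolding varsigma_def by (rule theI'[OF ex1_varsigma])
  then have ge: "is_gauss_epple n (compose (carrier (braid_group n)) (iota n) (varsigma n))"
    by (rule gauss_epple_compose)
  then have ex1: "\<exists>!f. is_gauss_epple n f"
    by (auto intro: gauss_epple_unique)
  moreover have "gauss_epple n = compose (carrier (braid_group n)) (iota n) (varsigma n)"
    unfolding gauss_epple_def using ge by (rule the1_equality[OF ex1])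
  ultimately show ?thesis
    using group_hom_iota inj_on_iota ex1_varsigma by blast
qed

end
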